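(* Let $k>3$ be an integer. For every $v\geq 4k$ with $v(v-1)\equiv 0\pmod{2k}$, \[\mathcal{L}_1S_k(v)=\{n\geq v-1\mid n\equiv 0,1\pmod 4\}.\]
   Context: All graphs are finite and simple; $\Gamma\leq K$ means $\Gamma$ is a subgraph of $K$ (or is isomorphic to one, when $\Gamma$ is an abstract graph). $P_3$ is the path on $3$ vertices; $S_k$ is the star on $k+1$ vertices, i.e. the complete bipartite graph $K_{1,k}$. For a graph $K$ and $\Gamma\leq K$, a $(K,\Gamma)$-design is a set $\mathcal{B}$ of subgraphs of $K$, called blocks, each isomorphic to $\Gamma$, whose edge-sets partition $E(K)$. $K_n$ is the complete graph on a set of $n$ vertices (any $n$-element vertex set may be used); a $\Gamma$-design of order $n$ is a $(K_n,\Gamma)$-design. Given $\Gamma'\leq\Gamma$, a $(K,\Gamma)$-design $\mathcal{B}$ and a $(K',\Gamma')$-design $\mathcal{B}'$, a down-link from $\mathcal{B}$ to $\mathcal{B}'$ is a function $f:\mathcal{B}\to\mathcal{B}'$ such that $f(B)$ is a subgraph of $B$ for every $B\in\mathcal{B}$ (the vertex sets of $K$ and $K'$ need not coincide, and either may be the larger). Take $\Gamma'=P_3$. For $v$ such that a $(K_v,\Gamma)$-design exists, $\mathcal{L}_1\Gamma(v)$ is the set of all integers $n$ such that some $\Gamma$-design of order $v$ can be down-linked to a $P_3$-design of order $n$. A $(K_v,S_k)$-design exists if and only if $v\geq 2k$ and $v(v-1)\equiv 0\pmod{2k}$. *)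

theory Defs
  imports Main "HOL-Library.FuncSet" "HOL-Library.Disjoint_Sets" "HOL-Number_Theory.Cong"
begin

record 'a graph =
  verts :: "'a set"
  edges :: "'a set set"

definition simple_graph :: "'a graph \<Rightarrow> bool" where
  "simple_graph G \<longleftrightarrow>
     finite (verts G) \<and> (\<forall>e\<in>edges G. e \<subseteq> verts G \<and> card e = 2)"

definition subgraph :: "'a graph \<Rightarrow> 'a graph \<Rightarrow> bool" where
  "subgraph H G \<longleftrightarrow>
     simple_graph H \<and> simple_graph G \<and> verts H \<subseteq> verts G \<and> edges H \<subseteq> edges G"

definition graph_iso :: "'a graph \<Rightarrow> 'b graph \<Rightarrow> bool" where
  "graph_iso G H \<longleftrightarrow>
     (\<exists>\<phi>. bij_betw \<phi> (verts G) (verts H) \<and> edges H = (\<lambda>e. \<phi> ` e) ` edges G)"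

definition complete_graph :: "'a set \<Rightarrow> 'a graph" where
  "complete_graph V = \<lparr>verts = V, edges = {e. e \<subseteq> V \<and> card e = 2}\<rparr>"

definition path_graph :: "nat \<Rightarrow> nat graph" where
  "path_graph n = \<lparr>verts = {..<n}, edges = {{i, Suc i} |i. Suc i < n}\<rparr>"

definition star_graph :: "nat \<Rightarrow> nat graph" where
  "star_graph k = \<lparr>verts = {0..k}, edges = {{0, i} |i. i \<in> {1..k}}\<rparr>"

text \<open>The injectivity clause says that distinct blocks contribute distinct parts, so that the
  edge-sets partition the edges of \<open>K\<close> as a family indexed by the blocks.\<close>

definition design :: "'a graph \<Rightarrow> 'b graph \<Rightarrow> 'a graph set \<Rightarrow> bool" where
  "design K \<Gamma> \<B> \<longleftrightarrow>
     (\<forall>B\<in>\<B>. subgraph B K \<and> graph_iso \<Gamma> B) \<and>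
     inj_on edges \<B> \<and> partition_on (edges K) (edges ` \<B>)"

definition design_of_order :: "nat \<Rightarrow> 'b graph \<Rightarrow> 'a graph set \<Rightarrow> bool" where
  "design_of_order n \<Gamma> \<B> \<longleftrightarrow>
     (\<exists>V. finite V \<and> card V = n \<and> design (complete_graph V) \<Gamma> \<B>)"

definition down_link :: "('a graph \<Rightarrow> 'a graph) \<Rightarrow> 'a graph set \<Rightarrow> 'a graph set \<Rightarrow> bool" where
  "down_link f \<B> \<B>' \<longleftrightarrow> f \<in> \<B> \<rightarrow> \<B>' \<and> (\<forall>B\<in>\<B>. subgraph (f B) B)"

text \<open>The vertices of the complete graphs are taken to be natural numbers. This is no
  restriction: two finite vertex sets, which may overlap in any way, can be relabelled
  simultaneously by an injection into the naturals.\<close>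

definition L1 :: "'b graph \<Rightarrow> nat \<Rightarrow> nat set" where
  "L1 \<Gamma> v = {n. \<exists>(\<B> :: nat graph set) (\<B>' :: nat graph set) f.
     design_of_order v \<Gamma> \<B> \<and> design_of_order n (path_graph 3) \<B>' \<and> down_link f \<B> \<B>'}"

end

theory Submission
  imports Defs
begin

text \<open>
  Necessity: the copy of \<open>P\<^sub>3\<close> assigned to a star contains the centre of the star, so every centre is
  a vertex of the small design; two vertices of \<open>K\<^sub>v\<close> outside it would be joined by an edge whose
  star is centred at one of them. The congruence is the parity of the number of edges.

  Sufficiency: an orientation of \<open>K\<^sub>v\<close> all of whose out-degrees are multiples of \<open>k\<close> is a star design.
  By Landau's theorem there is one in which vertex \<open>v - 1\<close> has out-degree \<open>0\<close>, vertex \<open>0\<close> has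
  out-degree \<open>k\<close>, and all others have nearly equal out-degrees, at least \<open>2 * k\<close>. In every star select
  two edges avoiding the vertex \<open>v - 1\<close> and, unless it is the centre, the vertex \<open>0\<close>. The unselected
  edges of the complete graph on \<open>{..<n}\<close> form a connected graph: if \<open>n \<ge> v\<close>, the vertex \<open>v - 1\<close> is
  adjacent to everything, and if \<open>n = v - 1\<close>, the vertex \<open>0\<close> misses at most two vertices, while every
  vertex has at least three neighbours. A connected graph with an even number of edges has an
  orientation with even out-degrees, hence decomposes into copies of \<open>P\<^sub>3\<close>.
\<close>

subsection \<open>Orientations with prescribed out-degrees or parities\<close>

text \<open>An orientation sends each edge to its tail.\<close>

definition orientation :: "'a set set \<Rightarrow> ('a set \<Rightarrow> 'a) \<Rightarrow> bool" where
  "orientation E h \<longleftrightarrow> (\<forall>e\<in>E. h e \<in> e)"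

definition outdeg :: "'a set set \<Rightarrow> ('a set \<Rightarrow> 'a) \<Rightarrow> 'a \<Rightarrow> nat" where
  "outdeg E h x = card {e \<in> E. h e = x}"

text \<open>The additive form avoids truncated subtraction and also covers
  \<open>y = h e\<close>.\<close>

lemma outdeg_upd:
  assumes "finite E" "e \<in> E"
  shows "outdeg E (h(e := y)) z + of_bool (z = h e) = outdeg E h z + of_bool (z = y)"
proof -
  have *: "outdeg E g z = card {a \<in> E - {e}. g a = z} + of_bool (z = g e)" for g
  proof -
    have "{a \<in> E. g a = z} = {a \<in> E - {e}. g a = z} \<union> (if z = g e then {e} else {})"
      using assms by auto
    moreover have "finite {a \<in> E - {e}. g a = z}" using assms by auto
    ultimately show ?thesis unfolding outdeg_def by auto
  qed
  have "{a \<in> E - {e}. (h(e := y)) a = z} = {a \<in> E - {e}. h a = z}" by auto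
  then show ?thesis using *[of h] *[of "h(e := y)"] by simp
qed

lemma sum_outdeg:
  assumes "finite V" "finite E" "\<And>e. e \<in> E \<Longrightarrow> h e \<in> V"
  shows "(\<Sum>x\<in>V. outdeg E h x) = card E"
  using sum.group[of E V h "\<lambda>_. 1::nat"] assms by (auto simp: outdeg_def)

text \<open>Moving the tail of each edge of a walk to its other end changes the parity at both ends
  of that edge; the changes cancel except at \<open>x\<close> and \<open>y\<close>. The walk may
  repeat edges, since only parities matter.\<close>

lemma toggle_parity:
  assumes "(\<lambda>u w. {u, w} \<in> E)\<^sup>*\<^sup>* x y" "finite E" "orientation E h"
  shows "\<exists>h'. orientation E h' \<and>
    (\<forall>z. even (outdeg E h' z + outdeg E h z + of_bool (z = x) + of_bool (z = y)))"
  using assms(1)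
proof induction
  case base
  show ?case using assms(3) by (intro exI[of _ h]) auto
next
  case (step y z)
  then obtain h' where h': "orientation E h'"
    "\<And>w. even (outdeg E h' w + outdeg E h w + of_bool (w = x) + of_bool (w = y))" by blast
  define e where "e = {y, z}"
  define y' where "y' = (if h' e = y then z else y)"
  have e: "e \<in> E" "h' e \<in> {y, z}" "y' \<in> e" "{h' e, y'} = {y, z}"
    using step(2) h'(1) by (auto simp: e_def orientation_def y'_def)
  have "orientation E (h'(e := y'))" using h'(1) e by (auto simp: orientation_def)
  moreover have "even (outdeg E (h'(e := y')) w + outdeg E h w + of_bool (w = x) + of_bool (w = z))" for w
  proof -
    let ?b = "\<lambda>u. even (of_bool (w = u) :: nat)"
    have "even (outdeg E (h'(e := y')) w + of_bool (w = h' e)) = even (outdeg E h' w + of_bool (w = y'))"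
      using outdeg_upd[OF assms(2) e(1), of h' y' w] by simp
    moreover have "(?b (h' e) = ?b y') = (?b y = ?b z)"
      using e(2) by (auto simp: y'_def)
    ultimately show ?thesis using h'(2)[of w] unfolding even_add by argo
  qed
  ultimately show ?case by blast
qed

text \<open>By double counting there are evenly many vertices of odd out-degree, so in an orientation with
  the fewest of them two could be repaired at once by toggling along a walk.\<close>

lemma even_orientation:
  assumes "finite V" "\<And>e. e \<in> E \<Longrightarrow> e \<subseteq> V \<and> e \<noteq> {}" "even (card E)"
    and conn: "\<And>x y. x \<in> V \<Longrightarrow> y \<in> V \<Longrightarrow> (\<lambda>u w. {u, w} \<in> E)\<^sup>*\<^sup>* x y"
  shows "\<exists>h. orientation E h \<and> (\<forall>x. even (outdeg E h x))"
proof -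
  have fE: "finite E" using assms(1,2) by (meson Pow_iff finite_Pow_iff finite_subset subsetI)
  define D where "D h = {x \<in> V. odd (outdeg E h x)}" for h
  have "orientation E (\<lambda>e. SOME x. x \<in> e)"
    unfolding orientation_def using assms(2) by (metis ex_in_conv someI_ex)
  then obtain h where h: "orientation E h" "\<And>g. orientation E g \<Longrightarrow> card (D h) \<le> card (D g)"
    using ex_has_least_nat[of "orientation E" _ "\<lambda>h. card (D h)"] by blast
  have "even (\<Sum>x\<in>V. outdeg E h x)"
    using sum_outdeg[OF assms(1) fE, of h] h(1) assms(2,3) unfolding orientation_def by fastforce
  then have ev: "even (card (D h))" using assms(1) by (simp add: even_sum_iff D_def)
  have fD: "finite (D h)" using assms(1) by (simp add: D_def)
  have "D h = {}"
  proof (rule ccontr)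
    assume "D h \<noteq> {}"
    then obtain x where x: "x \<in> D h" by blast
    have "D h \<noteq> {x}" using ev by auto
    then obtain y where y: "y \<in> D h" "y \<noteq> x" using x by blast
    have "x \<in> V" "y \<in> V" using x y by (auto simp: D_def)
    from toggle_parity[OF conn[OF this] fE h(1)] obtain h' where h': "orientation E h'"
      "\<And>z. even (outdeg E h' z + outdeg E h z + of_bool (z = x) + of_bool (z = y))" by blast
    have "D h' \<subseteq> D h - {x}"
    proof
      fix z assume z: "z \<in> D h'"
      then show "z \<in> D h - {x}" using h'(2)[of z] x y
        by (cases "z = x"; cases "z = y") (auto simp: D_def)
    qed
    then have "card (D h') < card (D h)" using x fD
      by (metis card_Diff1_less card_mono finite_Diff le_less_trans)
    then show False using h(2)[OF h'(1)] by simp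
  qed
  moreover have "outdeg E h x = 0" if "x \<notin> V" for x
    using that h(1) assms(2) by (auto simp: outdeg_def orientation_def fE)
  ultimately have "even (outdeg E h x)" for x by (cases "x \<in> V") (auto simp: D_def)
  then show ?thesis using h(1) by blast
qed

text \<open>Inner vertices lose one outgoing edge and gain one, so a unit of out-degree passes from
  the start to the end. Distinctness keeps the later edges intact when the first one is
  reversed.\<close>

lemma reverse_path:
  assumes "finite E" "orientation E h" "distinct (x # ps)"
    "successively (\<lambda>u w. {u, w} \<in> E \<and> h {u, w} = u) (x # ps)"
  shows "\<exists>h'. orientation E h' \<and>
    (\<forall>z. outdeg E h' z + of_bool (z = x) = outdeg E h z + of_bool (z = last (x # ps)))"
  using assms(2-4)
proof (induction ps arbitrary: h x)
  case Nil
  then show ?case by auto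
next
  case (Cons y ps)
  define g where "g = h({x, y} := y)"
  have E: "{x, y} \<in> E" "h {x, y} = x" using Cons.prems by auto
  have "orientation E g" using Cons.prems(1) by (auto simp: orientation_def g_def)
  moreover have "successively (\<lambda>u w. {u, w} \<in> E \<and> g {u, w} = u) (y # ps)"
  proof -
    have "successively (\<lambda>u w. {u, w} \<in> E \<and> h {u, w} = u) (y # ps)" using Cons.prems by simp
    then show ?thesis
      by (rule successively_mono) (use Cons.prems(2) in \<open>auto simp: g_def doubleton_eq_iff\<close>)
  qed
  ultimately obtain h' where h': "orientation E h'"
    "\<And>z. outdeg E h' z + of_bool (z = y) = outdeg E g z + of_bool (z = last (y # ps))"
    using Cons.IH[of g y] Cons.prems(2) by auto
  have "outdeg E h' z + of_bool (z = x) = outdeg E h z + of_bool (z = last (y # ps))" for z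
    using h'(2)[of z] outdeg_upd[OF assms(1) E(1), of h y z] E(2) by (simp add: g_def)
  then show ?case using h'(1) by (intro exI[of _ h']) auto
qed

text \<open>When the walk returns to a vertex already on the path, the path is cut back to that
  vertex.\<close>

lemma rtranclp_distinct_path:
  assumes "r\<^sup>*\<^sup>* x y"
  shows "\<exists>ps. distinct (x # ps) \<and> successively r (x # ps) \<and> last (x # ps) = y"
  using assms
proof induction
  case base
  show ?case by (intro exI[of _ "[]"]) auto
next
  case (step y z)
  then obtain ps where ps: "distinct (x # ps)" "successively r (x # ps)" "last (x # ps) = y" by blast
  show ?case
  proof (cases "z \<in> set (x # ps)")
    case False
    then show ?thesis using ps step(2)
      by (intro exI[of _ "ps @ [z]"]) (auto simp: successively_append_iff simp flip: append_Cons)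
  next
    case True
    then obtain us vs where uv: "x # ps = us @ z # vs" by (meson split_list)
    then obtain qs where qs: "us @ [z] = x # qs" by (cases us) auto
    have "x # ps = (us @ [z]) @ vs" using uv by simp
    then have "distinct (us @ [z])" "successively r (us @ [z])"
      using ps by (auto simp: successively_append_iff)
    moreover have "last (x # qs) = z" using qs by (metis last_snoc)
    ultimately show ?thesis using qs by (intro exI[of _ qs]) simp
  qed
qed

text \<open>Hakimi's criterion, the graph form of Landau's theorem. In an orientation of least total
  excess, a vertex above its target would reach one below it by a directed path, and reversing that
  path would lower the excess.\<close>

lemma hakimi_orientation:
  assumes "finite V" "\<And>e. e \<in> E \<Longrightarrow> e \<subseteq> V \<and> card e = 2"
    and total: "(\<Sum>x\<in>V. t x) = card E"
    and local: "\<And>X. X \<subseteq> V \<Longrightarrow> card {e \<in> E. e \<subseteq> X} \<le> (\<Sum>x\<in>X. t x)"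
  shows "\<exists>h. orientation E h \<and> (\<forall>x\<in>V. outdeg E h x = t x)"
proof -
  have fE: "finite E" using assms(1,2) by (meson Pow_iff finite_Pow_iff finite_subset subsetI)
  have ne: "e \<noteq> {}" if "e \<in> E" for e using assms(2)[OF that] by auto
  \<comment> \<open>Truncated subtraction: only excesses count, deficits contribute 0.\<close>
  define D where "D h = (\<Sum>x\<in>V. outdeg E h x - t x)" for h
  have "orientation E (\<lambda>e. SOME x. x \<in> e)"
    unfolding orientation_def using ne by (metis ex_in_conv someI_ex)
  then obtain h where h: "orientation E h" "\<And>g. orientation E g \<Longrightarrow> D h \<le> D g"
    using ex_has_least_nat[of "orientation E" _ D] by blast
  define r where "r = (\<lambda>u w. {u, w} \<in> E \<and> h {u, w} = u)"
  have le: "outdeg E h x \<le> t x" if "x \<in> V" for x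
  proof (rule ccontr)
    assume exc: "\<not> outdeg E h x \<le> t x"
    define R where "R = {y. r\<^sup>*\<^sup>* x y}"
    have RV: "R \<subseteq> V"
    proof
      fix y assume "y \<in> R"
      then have "r\<^sup>*\<^sup>* x y" by (simp add: R_def)
      then show "y \<in> V" by induction (use that assms(2) in \<open>auto simp: r_def\<close>)
    qed
    have fR: "finite R" using RV assms(1) finite_subset by blast
    have xR: "x \<in> R" by (simp add: R_def)
    \<comment> \<open>Every edge with its tail in \<open>R\<close> lies inside \<open>R\<close>, as
      \<open>R\<close> is closed under directed edges. Without a deficit in \<open>R\<close>, the
      excess at \<open>x\<close> would then violate \<open>local\<close>.\<close>
    have "\<exists>y\<in>R. outdeg E h y < t y"
    proof (rule ccontr)
      assume "\<not> ?thesis"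
      then have "(\<Sum>y\<in>R. t y) < (\<Sum>y\<in>R. outdeg E h y)"
        using exc xR fR by (intro sum_strict_mono_ex1) (auto simp: not_less intro!: bexI[of _ x])
      also have "\<dots> = card {e \<in> E. h e \<in> R}"
      proof -
        have "outdeg E h y = outdeg {e \<in> E. h e \<in> R} h y" if "y \<in> R" for y
          using that unfolding outdeg_def by (intro arg_cong[where f = card]) auto
        then have "(\<Sum>y\<in>R. outdeg E h y) = (\<Sum>y\<in>R. outdeg {e \<in> E. h e \<in> R} h y)"
          by (rule sum.cong[OF refl])
        also have "\<dots> = card {e \<in> E. h e \<in> R}" by (rule sum_outdeg) (use fR fE in auto)
        finally show ?thesis .
      qed
      also have "\<dots> \<le> card {e \<in> E. e \<subseteq> R}"
      proof (rule card_mono)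
        show "{e \<in> E. h e \<in> R} \<subseteq> {e \<in> E. e \<subseteq> R}"
        proof safe
          fix e w assume e: "e \<in> E" "h e \<in> R" "w \<in> e"
          show "w \<in> R"
          proof (cases "w = h e")
            case False
            have "h e \<in> e" "card e = 2" using e h(1) assms(2) by (auto simp: orientation_def)
            then have "e = {h e, w}" using e(3) False by (auto simp: card_2_iff)
            then have "r (h e) w" using e by (auto simp: r_def)
            then show ?thesis using e(2) by (auto simp: R_def)
          qed (use e in simp)
        qed
      qed (use fE in auto)
      also have "\<dots> \<le> (\<Sum>y\<in>R. t y)" by (rule local[OF RV])
      finally show False by simp
    qed
    then obtain y where y: "y \<in> R" "outdeg E h y < t y" by blast
    then obtain ps where ps: "distinct (x # ps)" "successively r (x # ps)" "last (x # ps) = y"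
      using rtranclp_distinct_path[of r x y] by (auto simp: R_def)
    obtain h' where h': "orientation E h'"
      "\<And>z. outdeg E h' z + of_bool (z = x) = outdeg E h z + of_bool (z = y)"
      using reverse_path[OF fE h(1) ps(1) ps(2)[unfolded r_def]] ps(3) by auto
    \<comment> \<open>The deficit at \<open>y\<close> absorbs the extra unit without creating an
      excess, while the excess at \<open>x\<close> drops.\<close>
    have "D h' < D h" unfolding D_def
    proof (rule sum_strict_mono_ex1)
      show "\<forall>z\<in>V. outdeg E h' z - t z \<le> outdeg E h z - t z"
      proof
        fix z assume "z \<in> V"
        show "outdeg E h' z - t z \<le> outdeg E h z - t z"
          using h'(2)[of z] y(2) by (cases "z = x"; cases "z = y") auto
      qed
      show "\<exists>z\<in>V. outdeg E h' z - t z < outdeg E h z - t z"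
        using h'(2)[of x] y(2) exc that by (intro bexI[of _ x]) (cases "x = y"; auto)+
    qed (use assms in simp)
    then show False using h(2)[OF h'(1)] by simp
  qed
  \<comment> \<open>Equal totals turn the pointwise bound into equality.\<close>
  have "(\<Sum>x\<in>V. outdeg E h x) = (\<Sum>x\<in>V. t x)"
    unfolding total using h(1) assms(2) by (intro sum_outdeg[OF assms(1) fE]) (auto simp: orientation_def)
  then have "outdeg E h x = t x" if "x \<in> V" for x
    using le that assms(1) by (metis sum_mono_inv)
  then show ?thesis using h(1) by blast
qed

subsection \<open>Designs from partitions of the edge set\<close>

lemma equal_partition:
  assumes "finite S" "k > 0" "k dvd card S"
  shows "\<exists>P. partition_on S P \<and> (\<forall>p\<in>P. card p = k)"
  using assms
proof (induction "card S" arbitrary: S rule: less_induct)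
  case less
  show ?case
  proof (cases "S = {}")
    case True
    then show ?thesis by (intro exI[of _ "{}"]) (auto simp: partition_on_def)
  next
    case False
    then have "k \<le> card S" using less.prems by (simp add: dvd_imp_le card_gt_0_iff)
    then obtain T where T: "T \<subseteq> S" "card T = k" "finite T"
      by (meson obtain_subset_with_card_n)
    have c: "card (S - T) = card S - k" using T by (simp add: card_Diff_subset)
    then obtain P where P: "partition_on (S - T) P" "\<forall>p\<in>P. card p = k"
      using less.hyps[of "S - T"] less.prems \<open>k \<le> card S\<close> by auto
    have "T \<noteq> {}" using T(2) less.prems(2) by auto
    then have "partition_on S (insert T P)"
      using P(1) T(1) by (auto simp: partition_on_def disjoint_def)
    then show ?thesis using P(2) T(2) by (intro exI[of _ "insert T P"]) auto
  qed
qed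

text \<open>For an orientation \<open>h\<close>, a fibre consists of the edges leaving one vertex,
  so the parts are stars. This yields both the \<open>k\<close>-stars and, with 2 in place of
  \<open>k\<close>, the copies of P_3.\<close>

lemma fibre_partition:
  assumes "finite E" "k > 0" "\<And>x. k dvd card {e \<in> E. h e = x}"
  shows "\<exists>P. partition_on E P \<and> (\<forall>F\<in>P. card F = k \<and> (\<exists>x. \<forall>e\<in>F. h e = x))"
proof -
  have "\<forall>x. \<exists>P. partition_on {e \<in> E. h e = x} P \<and> (\<forall>p\<in>P. card p = k)"
    using assms by (intro allI equal_partition) auto
  then obtain Q where Q: "\<And>x. partition_on {e \<in> E. h e = x} (Q x)" "\<And>x p. p \<in> Q x \<Longrightarrow> card p = k"
    by metis
  have un: "\<Union> (Q x) = {e \<in> E. h e = x}" for x using partition_onD1[OF Q(1)] by (rule sym)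
  then have fib: "h e = x \<and> e \<in> E" if "p \<in> Q x" "e \<in> p" for p x e
    using that by fastforce
  have "partition_on E (\<Union>x. Q x)"
  proof (rule partition_onI)
    have "\<Union> (\<Union>x. Q x) = (\<Union>x. \<Union> (Q x))" by blast
    then show "\<Union> (\<Union>x. Q x) = E" by (auto simp: un)
    show "{} \<notin> (\<Union>x. Q x)" using partition_onD3[OF Q(1)] by auto
    show "disjnt p q" if pq: "p \<in> (\<Union>x. Q x)" "q \<in> (\<Union>x. Q x)" "p \<noteq> q" for p q
    \<comment> \<open>Parts sharing an edge \<open>e\<close> both belong to the partition of the
      fibre over \<open>h e\<close>.\<close>
    proof (rule ccontr)
      assume "\<not> disjnt p q"
      then obtain e where e: "e \<in> p" "e \<in> q" by (metis disjnt_iff)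
      obtain x y where "p \<in> Q x" "q \<in> Q y" using pq by blast
      then have "p \<in> Q (h e)" "q \<in> Q (h e)" using fib e by blast+
      then show False using partition_onD2[OF Q(1)] e pq(3) by (auto dest!: disjointD)
    qed
  qed
  then show ?thesis using fib Q(2) by (intro exI[of _ "\<Union>x. Q x"]) blast
qed

lemma card_equal_partition:
  assumes "partition_on E P" "finite E" "\<And>F. F \<in> P \<Longrightarrow> card F = k"
  shows "card E = k * card P"
  using card_partition[of P k] assms finite_elements[OF assms(2,1)]
  by (auto simp: partition_on_def disjoint_def)

text \<open>Stars and P_3 have no isolated vertices, so such blocks are determined by their edges
  and designs can be built as partitions of edge sets.\<close>

definition graph_of :: "'a set set \<Rightarrow> 'a graph" where
  "graph_of F = \<lparr>verts = \<Union>F, edges = F\<rparr>"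

lemma edges_graph_of [simp]: "edges (graph_of F) = F"
  by (simp add: graph_of_def)

lemma verts_graph_of [simp]: "verts (graph_of F) = \<Union>F"
  by (simp add: graph_of_def)

lemma subgraph_graph_of:
  assumes "simple_graph G" "F \<subseteq> edges G"
  shows "subgraph (graph_of F) G"
proof -
  have sub: "\<Union>F \<subseteq> verts G" using assms by (auto simp: simple_graph_def)
  moreover have "finite (\<Union>F)"
    by (rule finite_subset[OF sub]) (use assms(1) in \<open>simp add: simple_graph_def\<close>)
  moreover have "card e = 2" if "e \<in> F" for e using assms that by (auto simp: simple_graph_def)
  ultimately show ?thesis using assms unfolding subgraph_def
    by (auto simp: simple_graph_def[of "graph_of F"])
qed

lemma design_graph_of:
  assumes "simple_graph K" "partition_on (edges K) P" "\<And>F. F \<in> P \<Longrightarrow> graph_iso \<Gamma> (graph_of F)"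
  shows "design K \<Gamma> (graph_of ` P)"
proof -
  have "subgraph (graph_of F) K" if "F \<in> P" for F
    using assms(1) partition_onD1[OF assms(2)] that by (intro subgraph_graph_of) auto
  moreover have "inj_on edges (graph_of ` P)" by (auto intro: inj_onI)
  ultimately show ?thesis using assms(2,3) by (auto simp: design_def image_image)
qed

lemma graph_iso_trans:
  assumes "graph_iso G H" "graph_iso H K"
  shows "graph_iso G K"
proof -
  obtain f where f: "bij_betw f (verts G) (verts H) \<and> edges H = (\<lambda>e. f ` e) ` edges G"
    using assms(1) unfolding graph_iso_def by (rule exE)
  obtain g where g: "bij_betw g (verts H) (verts K) \<and> edges K = (\<lambda>e. g ` e) ` edges H"
    using assms(2) unfolding graph_iso_def by (rule exE)
  have "bij_betw (g \<circ> f) (verts G) (verts K)"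
    using bij_betw_trans[OF conjunct1[OF f] conjunct1[OF g]] .
  moreover have "edges K = (\<lambda>e. (g \<circ> f) ` e) ` edges G"
    using f g by (simp add: image_image image_comp)
  ultimately show ?thesis unfolding graph_iso_def by (intro exI[of _ "g \<circ> f"] conjI)
qed

lemma star_iso:
  assumes "card F = k" "k > 0" and F: "\<And>e. e \<in> F \<Longrightarrow> card e = 2 \<and> x \<in> e"
  shows "graph_iso (star_graph k) (graph_of F)"
proof -
  define L where "L = {y. {x, y} \<in> F}"
  have xL: "x \<notin> L" using F by (force simp: L_def)
  have FL: "F = (\<lambda>y. {x, y}) ` L"
  proof
    show "F \<subseteq> (\<lambda>y. {x, y}) ` L"
    proof
      fix e assume e: "e \<in> F"
      then obtain y where "e = {x, y}" using F[OF e] by (auto simp: card_2_iff)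
      then show "e \<in> (\<lambda>y. {x, y}) ` L" using e by (auto simp: L_def)
    qed
  qed (auto simp: L_def)
  have "inj_on (\<lambda>y. {x, y}) L" by (auto simp: inj_on_def doubleton_eq_iff)
  then have cL: "card L = k" using assms(1) by (simp add: FL card_image)
  \<comment> \<open>Infinite sets have cardinality 0, so \<open>k > 0\<close> gives
    finiteness.\<close>
  then have "finite L" using assms(2) card.infinite by fastforce
  then obtain g where g: "bij_betw g {1..k} L"
    using finite_same_card_bij[of "{1..k}" L] cL by auto
  \<comment> \<open>The bijection onto the leaves is extended by sending the centre 0 to
    \<open>x\<close>.\<close>
  define \<phi> where "\<phi> = g(0 := x)"
  have \<phi>: "bij_betw \<phi> {1..k} L" using g by (rule bij_betw_cong[THEN iffD1, rotated]) (auto simp: \<phi>_def)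
  have "bij_betw \<phi> (insert 0 {1..k}) (insert x L)"
    using notIn_Un_bij_betw[of 0 "{1..k}" \<phi> L] \<phi> xL by (auto simp: \<phi>_def)
  moreover have "insert 0 {1..k} = {0..k}" by auto
  moreover have "insert x L = \<Union>F"
    unfolding FL using cL assms(2) by (cases "L = {}") auto
  moreover have "F = (\<lambda>e. \<phi> ` e) ` {{0, i} |i. i \<in> {1..k}}"
  proof -
    have "{{0, i} |i. i \<in> {1..k}} = (\<lambda>i. {0, i}) ` {1..k}" by auto
    then have "(\<lambda>e. \<phi> ` e) ` {{0, i} |i. i \<in> {1..k}} = (\<lambda>i. {x, \<phi> i}) ` {1..k}"
      by (simp add: image_image) (simp add: \<phi>_def)
    also have "\<dots> = (\<lambda>y. {x, y}) ` (\<phi> ` {1..k})" by (simp add: image_image)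
    finally show ?thesis using \<phi> by (simp add: FL bij_betw_def)
  qed
  ultimately show ?thesis unfolding graph_iso_def star_graph_def
    by (intro exI[of _ \<phi>]) simp
qed

lemma path_edges: "edges (path_graph 3) = {{0, 1}, {1, 2}}"
proof -
  have "{{i, Suc i} |i. Suc i < 3} = (\<lambda>i. {i, Suc i}) ` {..<2}" by auto
  then show ?thesis by (simp add: path_graph_def lessThan_Suc numeral_2_eq_2 insert_commute)
qed

text \<open>Lets \<open>star_iso\<close> recognise P_3 as two edges through a common vertex. The
  isomorphism swaps 0 and 1 because the middle of the path is 1.\<close>

lemma path_iso_star: "graph_iso (path_graph 3) (star_graph 2)"
proof -
  define \<phi> :: "nat \<Rightarrow> nat" where "\<phi> = id(0 := 1, 1 := 0)"
  have v: "{..<3::nat} = {0, 1, 2}" "{0..2::nat} = {0, 1, 2}" by auto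
  have "{{0, i} |i. i \<in> {1..2::nat}} = (\<lambda>i. {0, i}) ` {1, 2}" by force
  then have "edges (star_graph 2) = (\<lambda>e. \<phi> ` e) ` edges (path_graph 3)"
    unfolding path_edges by (simp add: star_graph_def \<phi>_def insert_commute)
  moreover have "bij_betw \<phi> (verts (path_graph 3)) (verts (star_graph 2))"
    by (auto simp: path_graph_def star_graph_def v bij_betw_def \<phi>_def)
  ultimately show ?thesis unfolding graph_iso_def by blast
qed

lemma iso_star_center:
  assumes "graph_iso (star_graph k) B"
  shows "\<exists>x. \<forall>e\<in>edges B. x \<in> e"
  using assms by (force simp: graph_iso_def star_graph_def)

lemma iso_path_card:
  assumes "graph_iso (path_graph 3) B"
  shows "card (edges B) = 2"
proof -
  obtain \<phi> where "bij_betw \<phi> (verts (path_graph 3)) (verts B) \<and>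
      edges B = (\<lambda>e. \<phi> ` e) ` edges (path_graph 3)"
    using assms unfolding graph_iso_def by (rule exE)
  then have bij: "bij_betw \<phi> (verts (path_graph 3)) (verts B)"
    and ed: "edges B = (\<lambda>e. \<phi> ` e) ` edges (path_graph 3)" by simp_all
  have "inj_on \<phi> {..<3}" using bij by (simp add: path_graph_def bij_betw_def)
  have "\<phi> 0 \<noteq> \<phi> 2" "\<phi> 0 \<noteq> \<phi> 1" "\<phi> 1 \<noteq> \<phi> 2"
    using \<open>inj_on \<phi> {..<3}\<close>[THEN inj_onD] by force+
  then show ?thesis unfolding ed path_edges by (auto simp: doubleton_eq_iff card_insert_if)
qed

section \<open>Complete graphs and the necessary conditions on \<open>n\<close>\<close>

lemma simple_complete_graph: "finite V \<Longrightarrow> simple_graph (complete_graph V)"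
  by (auto simp: simple_graph_def complete_graph_def)

lemma card_pairs:
  assumes "finite V"
  shows "card {e. e \<subseteq> V \<and> card e = 2} = card V choose 2"
  using n_subsets[OF assms] by simp

lemma even_choose_two: "even (n choose 2) \<longleftrightarrow> [n = 0] (mod 4) \<or> [n = 1] (mod 4)" for n :: nat
proof -
  have "even (n choose 2) \<longleftrightarrow> n mod 4 = 0 \<or> n mod 4 = 1"
  proof (induction n)
    case (Suc n)
    have "Suc n choose 2 = n + (n choose 2)" by (simp add: numeral_2_eq_2)
    then have "even (Suc n choose 2) \<longleftrightarrow> (even n \<longleftrightarrow> n mod 4 = 0 \<or> n mod 4 = 1)"
      using Suc by simp
    then show ?case by presburger
  qed (simp add: numeral_2_eq_2)
  then show ?thesis by (simp add: cong_def)
qed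

lemma down_link_imp:
  assumes "n \<in> L1 (star_graph k) v"
  shows "n \<ge> v - 1" "even (n choose 2)"
proof -
  obtain \<B> \<B>' :: "nat graph set" and f V W where *:
    "finite V" "card V = v" "design (complete_graph V) (star_graph k) \<B>"
    "finite W" "card W = n" "design (complete_graph W) (path_graph 3) \<B>'"
    "down_link f \<B> \<B>'"
    using assms unfolding L1_def design_of_order_def by blast
  have P: "partition_on (edges (complete_graph W)) (edges ` \<B>')"
    using *(6) by (simp add: design_def)
  have "\<And>F. F \<in> edges ` \<B>' \<Longrightarrow> card F = 2"
    using *(6) iso_path_card by (auto simp: design_def)
  from card_equal_partition[OF P _ this] *(4)
  have "card (edges (complete_graph W)) = 2 * card (edges ` \<B>')"
    by (simp add: complete_graph_def)
  then show "even (n choose 2)"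
    using card_pairs[OF *(4)] *(5) by (simp add: complete_graph_def)
  have "card (V - W) \<le> 1"
  proof (rule ccontr)
    assume "\<not> ?thesis"
    then obtain p q where pq: "p \<in> V - W" "q \<in> V - W" "p \<noteq> q"
      using *(1) by (metis One_nat_def card_le_Suc0_iff_eq finite_Diff)
    have "{p, q} \<in> edges (complete_graph V)" using pq by (auto simp: complete_graph_def)
    moreover have "partition_on (edges (complete_graph V)) (edges ` \<B>)"
      using *(3) by (simp add: design_def)
    ultimately obtain B where B: "B \<in> \<B>" "{p, q} \<in> edges B"
      using partition_onD1 by blast
    obtain x where x: "\<And>e. e \<in> edges B \<Longrightarrow> x \<in> e"
      using B(1) *(3) iso_star_center by (metis design_def)
    have fB: "f B \<in> \<B>'" "subgraph (f B) B" using *(7) B(1) by (auto simp: down_link_def)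
    \<comment> \<open>An edge of \<open>f B\<close> lies in \<open>W\<close> and passes through the
      centre \<open>x\<close> of \<open>B\<close>, so \<open>x\<close> is in
      \<open>W\<close>.\<close>
    have "card (edges (f B)) = 2" "subgraph (f B) (complete_graph W)"
      using fB *(6) iso_path_card by (auto simp: design_def)
    moreover from this obtain e where "e \<in> edges (f B)" by fastforce
    ultimately have "e \<in> edges (f B)" "e \<subseteq> W" by (auto simp: subgraph_def complete_graph_def)
    then have "x \<in> W" using x fB(2) by (auto simp: subgraph_def)
    moreover have "x \<in> {p, q}" using x B(2) by blast
    ultimately show False using pq by blast
  qed
  moreover have "card V - card W \<le> card (V - W)" by (rule diff_card_le_card_Diff[OF *(4)])
  ultimately show "n \<ge> v - 1" using *(2,5) by simp
qed

subsection \<open>Scores of the star design\<close>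

text \<open>Landau's condition for the \<open>r\<close> lowest scores when \<open>\<rho>\<close> of \<open>N\<close> vertices have score \<open>k * (q + 1)\<close>
  and the others \<open>k * q\<close>. The left side is convex in \<open>r\<close>, the right side is linear on both sides of
  \<open>N - \<rho>\<close>, so this breakpoint is the critical value.\<close>

lemma balanced_bound:
  fixes k q \<rho> N r s :: int
  assumes "k \<ge> 1" "q \<ge> 0" "N \<ge> 2 * k" "0 \<le> \<rho>" "\<rho> \<le> N"
    and total: "2 * k * (q * N + \<rho>) + 2 * k = (N + 2) * (N + 1)"
    and r: "0 \<le> r" "r \<le> N" and s: "s \<ge> 0" "s \<ge> r - (N - \<rho>)"
  shows "(r + 1) * (r + 2) \<le> 2 * (k * q * r + k * s) + 2 * k"
proof -
  define m where "m = N - \<rho>"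
  have m: "0 \<le> m" "m \<le> N" using assms by (auto simp: m_def)
  \<comment> \<open>Multiplying by \<open>N\<close> allows \<open>q\<close> to be eliminated through
    \<open>total\<close>; the sign then follows from \<open>N \<ge> 2 * k\<close>.\<close>
  have "N * (N + m + 3 - 2 * k * (q + 1)) = m * (N - 2 * k) + 2 * (k - 1)"
    using total unfolding m_def by algebra
  also have "\<dots> \<ge> 0" using m assms by simp
  finally have "N * (N + m + 3 - 2 * k * (q + 1)) \<ge> 0" .
  then have key: "N + m + 3 - 2 * k * (q + 1) \<ge> 0"
    using assms(1,3) by (simp add: zero_le_mult_iff)
  \<comment> \<open>From \<open>m\<close> on, the slack is a quadratic vanishing at
    \<open>x = N\<close> by \<open>total\<close>. Its other factor grows with \<open>x\<close>, so
    its value at \<open>m\<close>, which is \<open>key\<close>, decides the sign.\<close>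
  have large: "(x + 1) * (x + 2) \<le> 2 * (k * q * x + k * (x - m)) + 2 * k" if "m \<le> x" "x \<le> N" for x
  proof -
    have "2 * (k * q * x + k * (x - m)) + 2 * k - (x + 1) * (x + 2)
        = (N - x) * (N + x + 3 - 2 * k * (q + 1))"
      using total unfolding m_def by algebra
    also have "\<dots> \<ge> 0" using that key by (intro mult_nonneg_nonneg) auto
    finally show ?thesis by simp
  qed
  show ?thesis
  proof (cases "m \<le> r")
    case True
    have "k * (r - m) \<le> k * s" using s(2) assms(1) by (auto simp: m_def intro: mult_left_mono)
    then show ?thesis using large[OF True r(2)] by simp
  next
    case False
    \<comment> \<open>This is the slack without the term in \<open>s\<close>. If the bracket is
      negative at \<open>m\<close>, passing from \<open>m\<close> down to \<open>r\<close> only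
      raises the product, so the case \<open>x = m\<close> of \<open>large\<close> suffices.\<close>
    have "r * (2 * k * q - r - 3) + 2 * (k - 1) \<ge> 0"
    proof (cases "2 * k * q - m - 3 \<ge> 0")
      case True
      then show ?thesis using r False assms(1) by (intro add_nonneg_nonneg mult_nonneg_nonneg) auto
    next
      case neg: False
      have "m * (2 * k * q - m - 3) + 2 * (k - 1) \<ge> 0"
        using large[of m] m by (simp add: algebra_simps)
      moreover have "m * (2 * k * q - m - 3) \<le> r * (2 * k * q - m - 3)"
        using neg False by (intro mult_right_mono_neg) auto
      moreover have "r * (2 * k * q - m - 3) \<le> r * (2 * k * q - r - 3)"
        using r False by (intro mult_left_mono) auto
      ultimately show ?thesis by linarith
    qed
    moreover have "0 \<le> k * s" using assms(1) s(1) by simp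
    ultimately show ?thesis by (simp add: algebra_simps)
  qed
qed

lemma two_times_choose_two: "2 * (n choose 2) = n * (n - 1)"
  by (cases n) (auto simp: choose_two)

lemma choose_two_le_iff: "n choose 2 \<le> m \<longleftrightarrow> int n * (int n - 1) \<le> 2 * int m"
proof -
  have "int n * (int n - 1) = int (n * (n - 1))" by (cases n) (auto simp: algebra_simps)
  also have "\<dots> = 2 * int (n choose 2)" unfolding two_times_choose_two[symmetric] by simp
  finally show ?thesis by simp
qed

text \<open>Scores are \<open>k\<close> times a number of stars: none at \<open>v - 1\<close>, one
  at 0, and the rest shared as evenly as possible. The last two conclusions are the hypotheses of
  \<open>hakimi_orientation\<close> for the complete graph.\<close>

lemma balanced_scores:
  fixes k v :: nat
  assumes "k > 0" "v \<ge> 4 * k" "2 * k dvd v * (v - 1)"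
  obtains t :: "nat \<Rightarrow> nat" where "t (v - 1) = 0" "t 0 = k"
    "\<And>x. x \<in> {1..<v - 1} \<Longrightarrow> 2 * k \<le> t x" "\<And>x. k dvd t x"
    "(\<Sum>x<v. t x) = v choose 2"
    "\<And>X. X \<subseteq> {..<v} \<Longrightarrow> card X choose 2 \<le> (\<Sum>x\<in>X. t x)"
proof -
  \<comment> \<open>\<open>M\<close> is the number of stars, as \<open>v choose 2\<close> equals
    \<open>k * M\<close>.\<close>
  obtain M where M: "v * (v - 1) = 2 * k * M" using assms(3) by blast
  define N where "N = v - 2"
  have v: "v = N + 2" "N \<ge> 1" "2 * k \<le> N" using assms(1,2) by (auto simp: N_def)
  have "2 * k * (2 * (v - 1)) \<le> v * (v - 1)"
    using mult_right_mono[OF assms(2), of "v - 1"] by (simp add: algebra_simps)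
  then have "2 * (v - 1) \<le> M" unfolding M using assms(1) by simp
  then have MN: "2 * N \<le> M - 1" "M \<ge> 1" using v by auto
  \<comment> \<open>One star is reserved for vertex 0; the other \<open>M - 1\<close> are
    distributed over \<open>N\<close> vertices, and \<open>v \<ge> 4 * k\<close> leaves at least two
    for each.\<close>
  define q \<rho> where "q = (M - 1) div N" and "\<rho> = (M - 1) mod N"
  have q: "q \<ge> 2" using MN(1) v(2) div_le_mono[of "2 * N" "M - 1" N] by (simp add: q_def)
  have qr: "q * N + \<rho> = M - 1" "\<rho> < N" using v(2) by (auto simp: q_def \<rho>_def)
  define U where "U = {1..<v - 1}"
  have U: "finite U" "card U = N" using v by (auto simp: U_def)
  \<comment> \<open>The vertices centring one extra star.\<close>
  define P where "P = {1..\<rho>}"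
  have P: "P \<subseteq> U" "card P = \<rho>" using qr v by (auto simp: P_def U_def)
  define t where "t x = (if x = 0 then k else if x \<in> U then k * q + k * of_bool (x \<in> P) else 0)" for x
  have V: "{..<v} = insert 0 (insert (v - 1) U)" "0 \<notin> U" "v - 1 \<notin> U" "v - 1 \<noteq> 0"
    using v by (auto simp: U_def)
  have sumA: "(\<Sum>x\<in>A. t x) = k * q * card A + k * card (A \<inter> P)" if "A \<subseteq> U" for A
  proof -
    have "finite A" using that U(1) finite_subset by blast
    have "(\<Sum>x\<in>A. t x) = (\<Sum>x\<in>A. k * q + k * of_bool (x \<in> P))"
      using that V by (intro sum.cong) (auto simp: t_def)
    also have "\<dots> = k * q * card A + k * (\<Sum>x\<in>A. of_bool (x \<in> P))"
      by (simp add: sum.distrib sum_distrib_left)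
    also have "(\<Sum>x\<in>A. of_bool (x \<in> P)) = card (A \<inter> P)"
      using \<open>finite A\<close> by (simp add: sum.If_cases of_bool_def)
    finally show ?thesis .
  qed
  have tot: "2 * k * (q * N + \<rho>) + 2 * k = (N + 2) * (N + 1)"
  proof -
    have "2 * k * (q * N + \<rho>) + 2 * k = 2 * k * (q * N + \<rho> + 1)" by simp
    also have "\<dots> = v * (v - 1)" using qr MN(2) M by simp
    finally show ?thesis using v by simp
  qed
  show ?thesis
  proof
    show "t (v - 1) = 0" "t 0 = k" using V by (auto simp: t_def)
    show "2 * k \<le> t x" if "x \<in> {1..<v - 1}" for x
      using that mult_le_mono2[OF q, of k] by (auto simp: t_def U_def)
    show "k dvd t x" for x by (simp add: t_def)
    show "(\<Sum>x<v. t x) = v choose 2"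
    proof -
      have "(\<Sum>x<v. t x) = k + (k * q * N + k * \<rho>)"
        using sumA[of U] V U P by (simp add: t_def Int_absorb1)
      then have "2 * (\<Sum>x<v. t x) = v * (v - 1)" using tot v by (simp add: algebra_simps)
      then show ?thesis by (simp add: choose_two)
    qed
    show "card X choose 2 \<le> (\<Sum>x\<in>X. t x)" if X: "X \<subseteq> {..<v}" for X
    proof -
      define A where "A = X \<inter> U"
      define r where "r = card A"
      have fX: "finite X" using X finite_subset by blast
      have fA: "finite A" "A \<subseteq> U" using U by (auto simp: A_def)
      have r: "r \<le> N" using card_mono[OF U(1) fA(2)] U(2) by (simp add: r_def)
      have "card (A \<union> P) \<le> N" using card_mono[OF U(1), of "A \<union> P"] fA P U(2) by auto
      then have s: "r + \<rho> \<le> N + card (A \<inter> P)"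
        using card_Un_Int[of A P] fA P(2) by (simp add: r_def P_def)
      \<comment> \<open>Twice Landau's inequality for \<open>A\<close> together with 0 and
        \<open>v - 1\<close>: there are \<open>r + 2\<close> vertices, and the term
        \<open>2 * int k\<close> comes from vertex 0.\<close>
      have bound: "(int r + 1) * (int r + 2) \<le> 2 * (int k * int q * int r + int k * int (card (A \<inter> P))) + 2 * int k"
      proof (rule balanced_bound[where N = "int N" and \<rho> = "int \<rho>"])
        show "2 * int k * (int q * int N + int \<rho>) + 2 * int k = (int N + 2) * (int N + 1)"
          using arg_cong[OF tot, of int] by (simp add: algebra_simps)
      qed (use assms(1) v qr r s in auto)
      have sX: "(\<Sum>x\<in>X. t x) = (\<Sum>x\<in>A. t x) + k * of_bool (0 \<in> X)"
      proof -
        have "(\<Sum>x\<in>X. t x) = (\<Sum>x\<in>A. t x) + (\<Sum>x\<in>X - A. t x)"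
          using fX by (metis A_def Int_lower1 sum.subset_diff add.commute)
        also have "(\<Sum>x\<in>X - A. t x) = (\<Sum>x\<in>X \<inter> {0}. t x)"
          using fX V by (intro sum.mono_neutral_right) (auto simp: A_def t_def)
        finally show ?thesis by (auto simp: t_def)
      qed
      \<comment> \<open>Vertex \<open>v - 1\<close> has score 0, so the worst case is that
        \<open>X\<close> contains it.\<close>
      have cX: "card X \<le> r + 1 + of_bool (0 \<in> X)"
      proof -
        have "X \<subseteq> A \<union> {v - 1} \<union> (X \<inter> {0})" using X V by (auto simp: A_def)
        then have "card X \<le> card (A \<union> {v - 1} \<union> (X \<inter> {0}))" using fA by (intro card_mono) auto
        also have "\<dots> \<le> r + 1 + card (X \<inter> {0})"
          using card_Un_le[of "A \<union> {v - 1}" "X \<inter> {0}"] card_Un_le[of A "{v - 1}"]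
          by (simp only: r_def) simp
        finally show ?thesis by auto
      qed
      have "(r + 1 + of_bool (0 \<in> X)) choose 2 \<le> (\<Sum>x\<in>X. t x)"
      proof (cases "0 \<in> X")
        case True
        then show ?thesis using bound unfolding choose_two_le_iff sX sumA[OF fA(2)]
          by (simp add: r_def algebra_simps)
      next
        case False
        \<comment> \<open>Dropping vertex 0 removes \<open>2 * (r + 1)\<close> on the left of
          \<open>bound\<close> and \<open>2 * k\<close> on the right. This is harmless if
          \<open>r + 1 \<ge> k\<close>; otherwise \<open>A\<close> is so small that
          \<open>k * q\<close> per vertex is enough.\<close>
        have "int r * (int r + 1) \<le> 2 * (int k * int q * int r + int k * int (card (A \<inter> P)))"
        proof (cases "r + 1 \<ge> k")
          case True
          then show ?thesis using bound by (simp add: algebra_simps)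
        next
          case False
          have "int r * (int r + 1) \<le> int r * (int k * int q)"
          proof (rule mult_left_mono)
            have "int k * 1 \<le> int k * int q" using q by (intro mult_left_mono) auto
            then show "int r + 1 \<le> int k * int q" using False by linarith
          qed simp
          also have "\<dots> \<le> 2 * (int k * int q * int r + int k * int (card (A \<inter> P)))"
            by (simp add: algebra_simps)
          finally show ?thesis .
        qed
        then show ?thesis using False unfolding choose_two_le_iff sX sumA[OF fA(2)]
          by (simp add: r_def algebra_simps)
      qed
      then show ?thesis using binomial_right_mono[OF cX, of 2] by simp
    qed
  qed
qed

subsection \<open>Selecting the paths and decomposing the rest\<close>

text \<open>The last three conclusions are what connectivity of the unselected edges requires, for
  \<open>n \<ge> v\<close> and for \<open>n = v - 1\<close>.\<close>

lemma star_selection: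
  fixes k v :: nat
  assumes k: "k > 3" and v: "v \<ge> 4 * k" and dvd: "2 * k dvd v * (v - 1)"
  obtains P :: "nat set set set" and \<sigma> where
    "partition_on {e. e \<subseteq> {..<v} \<and> card e = 2} P"
    "\<And>F. F \<in> P \<Longrightarrow> card F = k \<and> (\<exists>x. \<forall>e\<in>F. x \<in> e)"
    "\<And>F. F \<in> P \<Longrightarrow> \<sigma> F \<subseteq> F \<and> card (\<sigma> F) = 2"
    "\<And>e. e \<in> \<Union> (\<sigma> ` P) \<Longrightarrow> v - 1 \<notin> e"
    "card {y. {0, y} \<in> \<Union> (\<sigma> ` P)} \<le> 2"
    "\<And>x. x \<in> {1..<v - 1} \<Longrightarrow>
      3 \<le> card {y \<in> {..<v - 1}. y \<noteq> x \<and> {x, y} \<notin> \<Union> (\<sigma> ` P)}"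
proof -
  obtain t :: "nat \<Rightarrow> nat" where t: "t (v - 1) = 0" "t 0 = k"
    "\<And>x. x \<in> {1..<v - 1} \<Longrightarrow> 2 * k \<le> t x" "\<And>x. k dvd t x"
    "(\<Sum>x<v. t x) = v choose 2"
    "\<And>X. X \<subseteq> {..<v} \<Longrightarrow> card X choose 2 \<le> (\<Sum>x\<in>X. t x)"
    using balanced_scores[of k v] k v dvd by auto
  define E where "E = {e. e \<subseteq> {..<v} \<and> card e = 2}"
  have E: "e \<subseteq> {..<v}" "card e = 2" if "e \<in> E" for e using that by (auto simp: E_def)
  have fE: "finite E" by (rule finite_subset[of _ "Pow {..<v}"]) (auto simp: E_def)
  have "\<exists>h. orientation E h \<and> (\<forall>x\<in>{..<v}. outdeg E h x = t x)"
  proof (rule hakimi_orientation)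
    show "(\<Sum>x<v. t x) = card E" using card_pairs[of "{..<v}"] t(5) by (simp add: E_def)
    show "card {e \<in> E. e \<subseteq> X} \<le> (\<Sum>x\<in>X. t x)" if "X \<subseteq> {..<v}" for X
    proof -
      have "{e \<in> E. e \<subseteq> X} = {e. e \<subseteq> X \<and> card e = 2}" using that by (auto simp: E_def)
      then show ?thesis using card_pairs[of X] t(6)[OF that] finite_subset[OF that] by simp
    qed
  qed (auto simp: E_def)
  then obtain h where ori: "orientation E h" and deg: "\<And>x. x < v \<Longrightarrow> outdeg E h x = t x" by auto
  have he: "h e \<in> e" "h e < v" if "e \<in> E" for e
    using ori E(1)[OF that] that by (auto simp: orientation_def)
  have dvdh: "k dvd card {e \<in> E. h e = x}" for x
  proof (cases "x < v")
    case True
    then show ?thesis using deg t(4) by (simp add: outdeg_def)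
  next
    case False
    then have "{e \<in> E. h e = x} = {}" using he(2) by blast
    then show ?thesis by (simp only: card.empty dvd_0_right)
  qed
  from fibre_partition[OF fE _ dvdh] k obtain P where P: "partition_on E P"
    "\<And>F. F \<in> P \<Longrightarrow> card F = k" "\<And>F. F \<in> P \<Longrightarrow> \<exists>x. \<forall>e\<in>F. h e = x" by auto
  have PE: "e \<in> E" if "F \<in> P" "e \<in> F" for F e using partition_onD1[OF P(1)] that by auto
  have fP: "finite P" using finite_elements[OF fE P(1)] .
  have sink: "h e \<noteq> v - 1" if "e \<in> E" for e
  proof
    assume "h e = v - 1"
    then have "0 < outdeg E h (v - 1)" using that fE by (auto simp: outdeg_def card_gt_0_iff)
    then show False using deg[of "v - 1"] t(1) k v by simp
  qed
  \<comment> \<open>The centre \<open>x\<close> is not \<open>v - 1\<close>, so at most one edge of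
    the star goes to \<open>v - 1\<close> and at most one to 0. Since \<open>k \<ge> 4\<close>, two
    edges remain.\<close>
  have "\<exists>T. T \<subseteq> F \<and> card T = 2 \<and> (\<forall>e\<in>T. v - 1 \<notin> e \<and> (0 \<in> e \<longrightarrow> h e = 0))" if F: "F \<in> P" for F
  proof -
    obtain x where x: "\<And>e. e \<in> F \<Longrightarrow> h e = x" using P(3)[OF F] by auto
    have fF: "finite F" using P(2)[OF F] k by (metis card.infinite not_less_zero)
    have "card F \<le> card (F - {{x, v - 1}, {x, 0}}) + card {{x, v - 1}, {x, 0}}"
      using fF diff_card_le_card_Diff[of "{{x, v - 1}, {x, 0}}" F] by simp
    moreover have "card {{x, v - 1}, {x, 0}} \<le> 2" by (simp add: card_insert_if)
    ultimately have "2 \<le> card (F - {{x, v - 1}, {x, 0}})" using P(2)[OF F] k by linarith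
    then obtain T where T: "T \<subseteq> F - {{x, v - 1}, {x, 0}}" "card T = 2"
      by (meson obtain_subset_with_card_n)
    have "v - 1 \<notin> e \<and> (0 \<in> e \<longrightarrow> h e = 0)" if e: "e \<in> T" for e
    proof -
      have eF: "e \<in> F" using e T(1) by auto
      then have eE: "e \<in> E" using PE F by auto
      have xe: "x \<in> e" "x \<noteq> v - 1" using he(1)[OF eE] sink[OF eE] x[OF eF] by auto
      then obtain y where "e = {x, y}" using E(2)[OF eE] by (auto simp: card_2_iff)
      then show ?thesis using xe e T(1) x[OF eF] by auto
    qed
    then show ?thesis using T by auto
  qed
  then have "\<forall>F\<in>P. \<exists>T. T \<subseteq> F \<and> card T = 2 \<and> (\<forall>e\<in>T. v - 1 \<notin> e \<and> (0 \<in> e \<longrightarrow> h e = 0))"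
    by (intro ballI)
  then obtain \<sigma> where \<sigma>: "\<forall>F\<in>P. \<sigma> F \<subseteq> F \<and> card (\<sigma> F) = 2 \<and>
      (\<forall>e\<in>\<sigma> F. v - 1 \<notin> e \<and> (0 \<in> e \<longrightarrow> h e = 0))"
    by (rule bchoice[THEN exE])
  define S where "S = \<Union> (\<sigma> ` P)"
  have S: "e \<in> E" "v - 1 \<notin> e" "0 \<in> e \<Longrightarrow> h e = 0" if e: "e \<in> S" for e
  proof -
    obtain F where F: "F \<in> P" "e \<in> \<sigma> F" using e by (auto simp: S_def)
    then show "e \<in> E" using \<sigma> PE by blast
    show "v - 1 \<notin> e" "0 \<in> e \<Longrightarrow> h e = 0" using \<sigma> F by auto
  qed
  have fS: "finite S" by (rule finite_subset[OF subsetI[OF S(1)] fE])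
  \<comment> \<open>Each star centred at \<open>x\<close> has \<open>k\<close> edges, of which two
    are selected.\<close>
  have few: "k * card {e \<in> S. h e = x} \<le> 2 * card {e \<in> E. h e = x}" for x
  proof -
    define Px where "Px = {F \<in> P. \<forall>e\<in>F. h e = x}"
    have fx: "finite Px" using fP by (simp add: Px_def)
    have mem: "F \<in> Px" if "F \<in> P" "e \<in> F" "h e = x" for F e
      using that P(3)[of F] by (auto simp: Px_def)
    have "{e \<in> S. h e = x} \<subseteq> (\<Union>F\<in>Px. \<sigma> F)"
      using mem \<sigma> by (fastforce simp: S_def)
    moreover have "finite (\<Union>F\<in>Px. \<sigma> F)"
      by (rule finite_subset[OF _ fS]) (auto simp: S_def Px_def)
    ultimately have "card {e \<in> S. h e = x} \<le> card (\<Union>F\<in>Px. \<sigma> F)" by (rule card_mono[rotated])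
    also have "\<dots> \<le> (\<Sum>F\<in>Px. card (\<sigma> F))" by (rule card_UN_le[OF fx])
    also have "\<dots> = 2 * card Px" using \<sigma> by (simp add: Px_def)
    finally have *: "card {e \<in> S. h e = x} \<le> 2 * card Px" .
    have "partition_on {e \<in> E. h e = x} Px"
    proof (rule partition_onI)
      show "\<Union>Px = {e \<in> E. h e = x}"
        using partition_onD1[OF P(1)] mem by (auto simp: Px_def)
      show "disjnt p q" if "p \<in> Px" "q \<in> Px" "p \<noteq> q" for p q
        using partition_onD2[OF P(1)] that by (auto simp: Px_def disjnt_def dest: disjointD)
      show "{} \<notin> Px" using partition_onD3[OF P(1)] by (auto simp: Px_def)
    qed
    then have "card {e \<in> E. h e = x} = k * card Px"
      by (rule card_equal_partition) (use fE P(2) in \<open>auto simp: Px_def\<close>)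
    then show ?thesis using mult_le_mono2[OF *, of k] by simp
  qed
  have inj: "inj_on (\<lambda>y. {x, y}) Y" for x :: nat and Y by (auto simp: inj_on_def doubleton_eq_iff)
  show ?thesis
  proof
    show "partition_on {e. e \<subseteq> {..<v} \<and> card e = 2} P" using P(1) by (simp add: E_def)
    show "card F = k \<and> (\<exists>x. \<forall>e\<in>F. x \<in> e)" if "F \<in> P" for F
      using P(2,3)[OF that] PE[OF that] he(1) by metis
    show "\<sigma> F \<subseteq> F \<and> card (\<sigma> F) = 2" if "F \<in> P" for F using \<sigma> that by auto
    show "v - 1 \<notin> e" if "e \<in> \<Union> (\<sigma> ` P)" for e using S(2) that by (simp add: S_def)
    show "card {y. {0, y} \<in> \<Union> (\<sigma> ` P)} \<le> 2"
    proof -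
      have "(\<lambda>y. {0, y}) ` {y. {0, y} \<in> S} \<subseteq> {e \<in> S. h e = 0}" using S(3) by auto
      then have "card ((\<lambda>y. {0, y}) ` {y. {0, y} \<in> S}) \<le> card {e \<in> S. h e = 0}"
        using fS by (intro card_mono) auto
      then have "card {y. {0, y} \<in> S} \<le> card {e \<in> S. h e = 0}" by (simp add: card_image inj)
      \<comment> \<open>Vertex 0 has out-degree \<open>k\<close>, hence centres a single
        star.\<close>
      moreover have "k * card {e \<in> S. h e = 0} \<le> k * 2"
        using few[of 0] deg[of 0] t(2) k v by (simp add: outdeg_def)
      ultimately show ?thesis using k by (simp add: S_def)
    qed
    show "3 \<le> card {y \<in> {..<v - 1}. y \<noteq> x \<and> {x, y} \<notin> \<Union> (\<sigma> ` P)}" if x: "x \<in> {1..<v - 1}" for x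
    proof -
      \<comment> \<open>Outgoing edges suffice: with \<open>p \<ge> 2\<close> stars at
        \<open>x\<close>, at least \<open>k * p - 2 * p - 1 \<ge> 2 * p - 1 \<ge> 3\<close>
        remain.\<close>
      define R where "R = {e \<in> E. h e = x} - {e \<in> S. h e = x} - {{x, v - 1}}"
      have "x < v" using x by auto
      then have "2 * k \<le> card {e \<in> E. h e = x}" using deg t(3)[OF x] by (simp add: outdeg_def)
      obtain p where p: "card {e \<in> E. h e = x} = k * p" using dvdh by blast
      have "2 \<le> p" using \<open>2 * k \<le> _\<close> k by (simp add: p)
      have "k * card {e \<in> S. h e = x} \<le> k * (2 * p)" using few[of x] by (simp add: p mult.left_commute)
      then have "card {e \<in> S. h e = x} \<le> 2 * p" using k by simp
      moreover have "4 * p \<le> k * p" using k by simp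
      moreover have "card R \<ge> card {e \<in> E. h e = x} - card {e \<in> S. h e = x} - 1"
      proof -
        have "card {e \<in> E. h e = x} - card {e \<in> S. h e = x} \<le> card ({e \<in> E. h e = x} - {e \<in> S. h e = x})"
          using fS by (intro diff_card_le_card_Diff) auto
        moreover have "card ({e \<in> E. h e = x} - {e \<in> S. h e = x}) - card {{x, v - 1}} \<le> card R"
          unfolding R_def by (intro diff_card_le_card_Diff) auto
        ultimately show ?thesis by simp
      qed
      ultimately have R3: "3 \<le> card R" using \<open>2 \<le> p\<close> unfolding p by linarith
      define Y where "Y = {y \<in> {..<v - 1}. y \<noteq> x \<and> {x, y} \<notin> S}"
      have "R \<subseteq> (\<lambda>y. {x, y}) ` Y"
      proof
        fix e assume e: "e \<in> R"
        then have eE: "e \<in> E" "h e = x" "e \<notin> S" "e \<noteq> {x, v - 1}" by (auto simp: R_def)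
        have xe: "x \<in> e" "card e = 2" using E(2)[OF eE(1)] he(1)[OF eE(1)] eE(2) by auto
        then obtain y where y: "e = {x, y}" by (auto simp: card_2_iff)
        then have "x \<noteq> y" using xe(2) by auto
        have "y < v" "y \<noteq> v - 1" using E(1)[OF eE(1)] y eE(4) by auto
        then show "e \<in> (\<lambda>y. {x, y}) ` Y" using y \<open>x \<noteq> y\<close> eE(3) by (auto simp: Y_def)
      qed
      then have "card R \<le> card ((\<lambda>y. {x, y}) ` Y)" by (intro card_mono) (auto simp: Y_def)
      then show ?thesis using R3 by (simp add: card_image inj Y_def S_def)
    qed
  qed
qed

text \<open>Even out-degrees allow the edges leaving each vertex to be paired, and each pair shares
  its tail. Reachability of one root \<open>r\<close> suffices because adjacency is
  symmetric.\<close>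

lemma even_path_partition:
  assumes "finite V" "\<And>e. e \<in> G \<Longrightarrow> e \<subseteq> V \<and> card e = 2" "even (card G)"
    and "r \<in> V" "\<And>x. x \<in> V \<Longrightarrow> (\<lambda>u w. {u, w} \<in> G)\<^sup>*\<^sup>* x r"
  shows "\<exists>Q. partition_on G Q \<and> (\<forall>F\<in>Q. card F = 2 \<and> (\<exists>x. \<forall>e\<in>F. x \<in> e))"
proof -
  have fG: "finite G" using assms(1,2) by (meson Pow_iff finite_Pow_iff finite_subset subsetI)
  have sym: "symp (\<lambda>u w. {u, w} \<in> G)" by (auto simp: symp_def insert_commute)
  have "(\<lambda>u w. {u, w} \<in> G)\<^sup>*\<^sup>* x y" if "x \<in> V" "y \<in> V" for x y
    using assms(5)[OF that(1)] sympD[OF symp_rtranclp[OF sym] assms(5)[OF that(2)]] by (rule rtranclp_trans)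
  moreover have "e \<subseteq> V \<and> e \<noteq> {}" if "e \<in> G" for e using assms(2)[OF that] by auto
  ultimately obtain h where h: "orientation G h" "\<And>x. even (outdeg G h x)"
    using even_orientation[OF assms(1) _ assms(3)] by blast
  have "\<exists>Q. partition_on G Q \<and> (\<forall>F\<in>Q. card F = 2 \<and> (\<exists>x. \<forall>e\<in>F. h e = x))"
    using h(2) by (intro fibre_partition[OF fG]) (auto simp: outdeg_def)
  then obtain Q where Q: "partition_on G Q" "\<And>F. F \<in> Q \<Longrightarrow> card F = 2"
    "\<And>F. F \<in> Q \<Longrightarrow> \<exists>x. \<forall>e\<in>F. h e = x" by auto
  have "\<exists>x. \<forall>e\<in>F. x \<in> e" if F: "F \<in> Q" for F
  proof -
    obtain x where "\<And>e. e \<in> F \<Longrightarrow> h e = x" using Q(3)[OF F] by auto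
    moreover have "h e \<in> e" if "e \<in> F" for e
      using h(1) partition_onD1[OF Q(1)] F that by (auto simp: orientation_def)
    ultimately show ?thesis by metis
  qed
  then show ?thesis using Q(1,2) by auto
qed

section \<open>Construction of the down-link\<close>

lemma down_link_exists:
  fixes k v n :: nat
  assumes k: "k > 3" and v: "v \<ge> 4 * k" and dvd: "2 * k dvd v * (v - 1)"
    and n: "n \<ge> v - 1" "even (n choose 2)"
  shows "n \<in> L1 (star_graph k) v"
proof (rule star_selection[OF k v dvd])
  fix P :: "nat set set set" and \<sigma>
  assume P: "partition_on {e. e \<subseteq> {..<v} \<and> card e = 2} P" and
    star: "\<And>F. F \<in> P \<Longrightarrow> card F = k \<and> (\<exists>x. \<forall>e\<in>F. x \<in> e)" and
    \<sigma>: "\<And>F. F \<in> P \<Longrightarrow> \<sigma> F \<subseteq> F \<and> card (\<sigma> F) = 2" and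
    sink: "\<And>e. e \<in> \<Union> (\<sigma> ` P) \<Longrightarrow> v - 1 \<notin> e" and
    zero: "card {y. {0, y} \<in> \<Union> (\<sigma> ` P)} \<le> 2" and
    many: "\<And>x. x \<in> {1..<v - 1} \<Longrightarrow>
      3 \<le> card {y \<in> {..<v - 1}. y \<noteq> x \<and> {x, y} \<notin> \<Union> (\<sigma> ` P)}"
  define S where "S = \<Union> (\<sigma> ` P)"
  define K where "K = {e. e \<subseteq> {..<n} \<and> card e = 2}"
  define G where "G = K - S"
  have PE: "e \<subseteq> {..<v} \<and> card e = 2" if "F \<in> P" "e \<in> F" for F e
    using partition_onD1[OF P] that by blast
  \<comment> \<open>Since selected edges avoid \<open>v - 1\<close>, they fit into \<open>K\<close>
    even for \<open>n = v - 1\<close>.\<close>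
  have SK: "S \<subseteq> K"
  proof
    fix e assume e: "e \<in> S"
    then have "e \<subseteq> {..<v}" "card e = 2" using PE \<sigma> unfolding S_def by blast+
    moreover have "v - 1 \<notin> e" using sink e by (simp add: S_def)
    moreover have "{..<v} - {v - 1} \<subseteq> {..<n}" using n(1) by auto
    ultimately show "e \<in> K" unfolding K_def by blast
  qed
  have fK: "finite K" by (rule finite_subset[of _ "Pow {..<n}"]) (auto simp: K_def)
  have fS: "finite S" by (rule finite_subset[OF SK fK])
  have partS: "partition_on S (\<sigma> ` P)"
  proof (rule partition_onI)
    show "\<Union> (\<sigma> ` P) = S" by (simp add: S_def)
    show "{} \<notin> \<sigma> ` P" using \<sigma> by fastforce
    show "disjnt p q" if "p \<in> \<sigma> ` P" "q \<in> \<sigma> ` P" "p \<noteq> q" for p q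
    proof -
      obtain A B where AB: "A \<in> P" "B \<in> P" "p = \<sigma> A" "q = \<sigma> B" using \<open>p \<in> \<sigma> ` P\<close> \<open>q \<in> \<sigma> ` P\<close> by auto
      then have "A \<noteq> B" using that(3) by auto
      then have "A \<inter> B = {}" using partition_onD2[OF P] AB(1,2) by (simp add: disjointD)
      then show ?thesis using AB \<sigma>[OF AB(1)] \<sigma>[OF AB(2)] unfolding disjnt_def by blast
    qed
  qed
  have adj: "{u, w} \<in> G" if "u < n" "w < n" "u \<noteq> w" "{u, w} \<notin> S" for u w
    using that by (auto simp: G_def K_def)
  have v1: "1 < v - 1" using k v by simp
  have "\<exists>Q. partition_on G Q \<and> (\<forall>F\<in>Q. card F = 2 \<and> (\<exists>x. \<forall>e\<in>F. x \<in> e))"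
  proof (rule even_path_partition[where V = "{..<n}" and r = "if n = v - 1 then 0 else v - 1"])
    show "e \<subseteq> {..<n} \<and> card e = 2" if "e \<in> G" for e using that by (auto simp: G_def K_def)
    have "card S = 2 * card (\<sigma> ` P)"
      by (rule card_equal_partition[OF partS fS]) (use \<sigma> in auto)
    moreover have "card K = n choose 2" using card_pairs[of "{..<n}"] by (simp add: K_def)
    ultimately show "even (card G)"
      using n(2) card_mono[OF fK SK] by (simp add: G_def card_Diff_subset[OF fS SK])
    show "(if n = v - 1 then 0 else v - 1) \<in> {..<n}" using n(1) v1 by auto
    show "(\<lambda>u w. {u, w} \<in> G)\<^sup>*\<^sup>* x (if n = v - 1 then 0 else v - 1)" if x: "x \<in> {..<n}" for x
    proof (cases "n = v - 1")
      case False
      have "{x, v - 1} \<in> G" if "x \<noteq> v - 1"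
        using x n(1) False that sink[of "{x, v - 1}"] by (intro adj) (auto simp: S_def)
      then show ?thesis using False by (cases "x = v - 1") auto
    next
      case True
      have step: "(\<lambda>u w. {u, w} \<in> G)\<^sup>*\<^sup>* y 0" if "y < n" "{0, y} \<notin> S" for y
        using adj[of y 0] that by (cases "y = 0") (auto simp: insert_commute)
      show ?thesis
      proof (cases "x = 0 \<or> {0, x} \<notin> S")
        case True
        then show ?thesis using step[of x] x \<open>n = v - 1\<close> by auto
      next
        case False
        \<comment> \<open>Of the three or more unselected neighbours of \<open>x\<close>, at most
          two are joined to 0 by a selected edge, so some \<open>y\<close> gives a path
          \<open>x\<close>, \<open>y\<close>, 0 in \<open>G\<close>.\<close>
        define Y where "Y = {y \<in> {..<v - 1}. y \<noteq> x \<and> {x, y} \<notin> S}"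
        have "3 \<le> card Y" using many[of x] x True False by (simp add: Y_def S_def)
        moreover have "finite {y. {0, y} \<in> S}"
        proof (rule finite_subset)
          show "{y. {0, y} \<in> S} \<subseteq> {..<n}" using SK by (auto simp: K_def)
        qed simp
        ultimately have "\<not> Y \<subseteq> {y. {0, y} \<in> S}"
          using zero card_mono[of "{y. {0, y} \<in> S}" Y] by (auto simp: S_def)
        then obtain y where y: "y < n" "y \<noteq> x" "{x, y} \<notin> S" "{0, y} \<notin> S" using True by (auto simp: Y_def)
        have "{x, y} \<in> G" using adj[of x y] x y by auto
        then have "(\<lambda>u w. {u, w} \<in> G)\<^sup>*\<^sup>* x 0" using step[OF y(1,4)] by (rule converse_rtranclp_into_rtranclp)
        then show ?thesis using True by simp
      qed
    qed
  qed simp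
  then obtain Q where Q: "partition_on G Q" "\<And>F. F \<in> Q \<Longrightarrow> card F = 2 \<and> (\<exists>x. \<forall>e\<in>F. x \<in> e)" by auto
  have partK: "partition_on K (\<sigma> ` P \<union> Q)"
  proof (rule partition_onI)
    have "\<Union>Q = G" "\<Union> (\<sigma> ` P) = S" using partition_onD1[OF Q(1)] by (auto simp: S_def)
    then show "\<Union> (\<sigma> ` P \<union> Q) = K" using SK unfolding Union_Un_distrib G_def by blast
    show "{} \<notin> \<sigma> ` P \<union> Q" using partition_onD3[OF partS] partition_onD3[OF Q(1)] by blast
    have "disjoint (\<sigma> ` P \<union> Q)"
      using \<open>\<Union>Q = G\<close> \<open>\<Union> (\<sigma> ` P) = S\<close> G_def
      by (intro disjoint_union partition_onD2[OF partS] partition_onD2[OF Q(1)]) auto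
    then show "disjnt p q" if "p \<in> \<sigma> ` P \<union> Q" "q \<in> \<sigma> ` P \<union> Q" "p \<noteq> q" for p q
      using that by (rule pairwiseD)
  qed
  have K2: "card e = 2" if "e \<in> K" for e using that by (simp add: K_def)
  have P3: "graph_iso (path_graph 3) (graph_of F)" if F: "F \<in> \<sigma> ` P \<union> Q" for F
  proof -
    have "card F = 2 \<and> (\<exists>x. \<forall>e\<in>F. x \<in> e)"
    proof (cases "F \<in> Q")
      case False
      then obtain A where "A \<in> P" "F = \<sigma> A" using F by auto
      then show ?thesis using \<sigma>[of A] star[of A] by blast
    qed (use Q(2) in auto)
    then obtain x where x: "card F = 2" "\<And>e. e \<in> F \<Longrightarrow> x \<in> e" by auto
    have "F \<subseteq> K" using partition_onD1[OF partK] F by blast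
    then have "graph_iso (star_graph 2) (graph_of F)" using x K2 by (intro star_iso[of F 2 x]) auto
    then show ?thesis by (rule graph_iso_trans[OF path_iso_star])
  qed
  have Sk: "graph_iso (star_graph k) (graph_of F)" if F: "F \<in> P" for F
  proof -
    obtain x where "card F = k" "\<And>e. e \<in> F \<Longrightarrow> x \<in> e" using star[OF F] by auto
    then show ?thesis using PE[OF F] k by (intro star_iso[of F k x]) auto
  qed
  have D1: "design (complete_graph {..<v}) (star_graph k) (graph_of ` P)"
    using P Sk by (intro design_graph_of simple_complete_graph) (auto simp: complete_graph_def)
  have D2: "design (complete_graph {..<n}) (path_graph 3) (graph_of ` (\<sigma> ` P \<union> Q))"
    using partK P3 by (intro design_graph_of simple_complete_graph) (auto simp: complete_graph_def K_def)
  \<comment> \<open>A block is mapped through its edge set, which recovers the part \<open>F\<close>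
    on which \<open>\<sigma>\<close> acts.\<close>
  have DL: "down_link (\<lambda>B. graph_of (\<sigma> (edges B))) (graph_of ` P) (graph_of ` (\<sigma> ` P \<union> Q))"
    unfolding down_link_def
  proof (intro conjI ballI)
    fix B assume "B \<in> graph_of ` P"
    then obtain F where F: "F \<in> P" "B = graph_of F" by auto
    have "subgraph B (complete_graph {..<v})" using D1 F by (auto simp: design_def)
    then show "subgraph (graph_of (\<sigma> (edges B))) B"
      using \<sigma>[OF F(1)] F(2) by (intro subgraph_graph_of) (auto simp: subgraph_def)
  qed auto
  have "design_of_order v (star_graph k) (graph_of ` P)"
    using D1 unfolding design_of_order_def by (intro exI[of _ "{..<v}"]) simp
  moreover have "design_of_order n (path_graph 3) (graph_of ` (\<sigma> ` P \<union> Q))"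
    using D2 unfolding design_of_order_def by (intro exI[of _ "{..<n}"]) simp
  ultimately show ?thesis unfolding L1_def using DL by blast
qed

theorem theorem5p2:
  fixes k v :: nat
  assumes "k > 3" and "v \<ge> 4 * k" and "[v * (v - 1) = 0] (mod (2 * k))"
  shows "L1 (star_graph k) v = {n. n \<ge> v - 1 \<and> ([n = 0] (mod 4) \<or> [n = 1] (mod 4))}"
proof -
  have "2 * k dvd v * (v - 1)" using assms(3) by (simp add: cong_0_iff)
  then show ?thesis
    using down_link_exists[OF assms(1,2)] down_link_imp even_choose_two by blast
qed

end
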